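(* Every set $A \subseteq \mathbb{N}$ with property $Q$ has upper density at most $\frac{6}{\pi^2}$.
   Context: $\mathrm{SF}$ denotes the set of squarefree positive integers. A set $A \subseteq \mathbb{N}$ has property $Q$ if there are infinitely many $n \in \mathbb{N}$ such that $n + a \in \mathrm{SF}$ for all $a \in A$ with $a < n$. For $x>0$, $[x] = \{n \in \mathbb{N}: n \le x\}$; the upper density of $A$ is $\limsup_{x \to \infty} |A \cap [x]|/x$. *)

theory Defs
  imports "HOL-Analysis.Analysis" "HOL-Computational_Algebra.Squarefree"
begin

definition SF :: "nat set" where
  "SF = {n. n > 0 \<and> squarefree n}"

text \<open>The natural numbers of the paper are rendered by the type \<^typ>\<open>nat\<close>. If they are
  understood to start at 1, everything below restricts literally to sets
  \<open>A \<subseteq> {1..}\<close>: then \<open>0 \<notin> A \<inter> initial_seg x\<close>, and whether \<open>n = 0\<close> counts is irrelevant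
  for the infinitude in \<open>property_Q\<close>.\<close>

definition property_Q :: "nat set \<Rightarrow> bool" where
  "property_Q A \<longleftrightarrow> infinite {n. \<forall>a\<in>A. a < n \<longrightarrow> n + a \<in> SF}"

definition initial_seg :: "real \<Rightarrow> nat set" where
  "initial_seg x = {n. real n \<le> x}"

text \<open>The limsup is over real \<open>x\<close>, and taken in \<^typ>\<open>ereal\<close> so that it always exists.\<close>

definition upper_density :: "nat set \<Rightarrow> ereal" where
  "upper_density A = Limsup at_top (\<lambda>x::real. ereal (real (card (A \<inter> initial_seg x)) / x))"

end

theory Submission
  imports Defs "HOL-Number_Theory.Cong"
begin

text \<open>
  Fix a bound \<open>N\<close> and let \<open>M\<close> be the product of the \<open>p\<^sup>2\<close> over the primes \<open>p \<le> N\<close>. By pigeonhole,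
  infinitely many of the \<open>n\<close> that witness property \<open>Q\<close> lie in one class \<open>r\<close> modulo \<open>M\<close>. Each
  \<open>a \<in> A\<close> is smaller than one of these \<open>n\<close>, so that no \<open>p\<^sup>2\<close> with \<open>p \<le> N\<close> divides \<open>a + r\<close>. By the
  Chinese remainder theorem, the density of \<open>A\<close> is at most the product of the \<open>1 - 1 / p\<^sup>2\<close>. An
  Euler product estimate bounds this by the inverse of the \<open>N\<close>-th partial sum of \<open>\<zeta>(2)\<close>, and
  \<open>N\<close> is arbitrary.
\<close>

text \<open>By the Chinese remainder theorem, \<open>x\<close> is determined by the residues of
  \<open>x + r\<close> modulo the \<open>m i\<close>. Each residue avoids 0, which leaves
  \<open>m i - 1\<close> values. Only an upper bound is claimed, so injectivity is enough.\<close>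

lemma card_shift_not_dvd_le:
  fixes m :: "'i \<Rightarrow> nat"
  assumes fin: "finite S" and pos: "\<And>i. i \<in> S \<Longrightarrow> m i > 0"
    and cop: "\<And>i j. i \<in> S \<Longrightarrow> j \<in> S \<Longrightarrow> i \<noteq> j \<Longrightarrow> coprime (m i) (m j)"
  shows "card {x. x < (\<Prod>i\<in>S. m i) \<and> (\<forall>i\<in>S. \<not> m i dvd x + r)} \<le> (\<Prod>i\<in>S. m i - 1)"
proof -
  let ?R = "{x. x < (\<Prod>i\<in>S. m i) \<and> (\<forall>i\<in>S. \<not> m i dvd x + r)}"
  let ?f = "\<lambda>x. \<lambda>i\<in>S. (x + r) mod m i"
  have "inj_on ?f ?R"
  proof (rule inj_onI)
    fix x y assume x: "x \<in> ?R" and y: "y \<in> ?R" and eq: "?f x = ?f y"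
    have "[x = y] (mod m i)" if "i \<in> S" for i
      using fun_cong[OF eq, of i] that cong_add_rcancel_nat[of x r y "m i"] by (simp add: cong_def)
    \<comment> \<open>The system of congruences is taken with target \<open>y\<close> itself, so
      that \<open>x\<close> and \<open>y\<close> both solve it.\<close>
    moreover have "\<exists>!z. z < (\<Prod>i\<in>S. m i) \<and> (\<forall>i\<in>S. [z = y] (mod m i))"
      using chinese_remainder_unique_nat[of S m "\<lambda>_. y"] fin pos cop by force
    ultimately show "x = y"
      using x y by (metis (no_types, lifting) cong_refl mem_Collect_eq)
  qed
  moreover have "?f ` ?R \<subseteq> (\<Pi>\<^sub>E i\<in>S. {1..<m i})"
    using pos by (auto simp: Suc_le_eq dvd_eq_mod_eq_0)
  moreover have "finite (\<Pi>\<^sub>E i\<in>S. {1..<m i})"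
    using fin by (intro finite_PiE) auto
  ultimately have "card ?R \<le> card (\<Pi>\<^sub>E i\<in>S. {1..<m i})"
    by (rule card_inj_on_le)
  then show ?thesis
    using fin by (simp add: card_PiE)
qed

text \<open>A block of \<open>M\<close> consecutive numbers starting at a multiple of
  \<open>M\<close> contains at most \<open>card R\<close> elements of \<open>A\<close>, and at most
  \<open>x / M + 1\<close> blocks start below or at \<open>x\<close>. The incomplete last block
  contributes at most \<open>card R / x\<close> to the ratio, which vanishes in the limit.\<close>

lemma upper_density_le_residues:
  assumes M: "M > 0" and fin: "finite R" and res: "\<And>a. a \<in> A \<Longrightarrow> a mod M \<in> R"
  shows "upper_density A \<le> ereal (real (card R) / real M)"
proof -
  have count: "real (card (A \<inter> initial_seg x)) \<le> real (card R) * (x / real M + 1)" if x: "x > 0" for x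
  proof -
    let ?k = "nat \<lfloor>x\<rfloor> div M"
    have "inj_on (\<lambda>a. (a div M, a mod M)) (A \<inter> initial_seg x)"
      by (rule inj_onI) (metis Pair_inject div_mult_mod_eq)
    moreover have "(\<lambda>a. (a div M, a mod M)) ` (A \<inter> initial_seg x) \<subseteq> {..?k} \<times> R"
      using res by (auto simp: initial_seg_def le_nat_floor intro!: div_le_mono)
    ultimately have "card (A \<inter> initial_seg x) \<le> card ({..?k} \<times> R)"
      by (rule card_inj_on_le) (use fin in auto)
    also have "\<dots> = card R * (?k + 1)"
      by (simp add: card_cartesian_product)
    finally have "real (card (A \<inter> initial_seg x)) \<le> real (card R) * (real ?k + 1)"
      by (metis of_nat_1 of_nat_add of_nat_le_iff of_nat_mult)
    moreover have "real ?k \<le> x / real M"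
    proof -
      have "real ?k \<le> real (nat \<lfloor>x\<rfloor>) / real M"
        by (rule of_nat_div_le_of_nat)
      also have "\<dots> \<le> x / real M"
        using x by (intro divide_right_mono) auto
      finally show ?thesis .
    qed
    ultimately show ?thesis
      by (meson add_right_mono mult_left_mono of_nat_0_le_iff order_trans)
  qed
  have "((\<lambda>x. real (card R) / real M + real (card R) / x) \<longlongrightarrow> real (card R) / real M + 0) at_top"
    by (rule tendsto_add[OF tendsto_const tendsto_divide_0[OF tendsto_const
        filterlim_at_top_imp_at_infinity[OF filterlim_ident]]])
  then have lim: "((\<lambda>x. ereal (real (card R) / real M + real (card R) / x)) \<longlongrightarrow>
      ereal (real (card R) / real M)) at_top"
    by simp
  have "\<forall>\<^sub>F x in at_top. ereal (real (card (A \<inter> initial_seg x)) / x)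
      \<le> ereal (real (card R) / real M + real (card R) / x)"
    using eventually_gt_at_top[of 0]
  proof eventually_elim
    case (elim x)
    have "real (card (A \<inter> initial_seg x)) / x \<le> real (card R) * (x / real M + 1) / x"
      using count[OF elim] elim by (intro divide_right_mono) auto
    also have "\<dots> = real (card R) / real M + real (card R) / x"
      using elim M by (simp add: field_simps)
    finally show ?case by simp
  qed
  then have "upper_density A \<le> Limsup at_top (\<lambda>x. ereal (real (card R) / real M + real (card R) / x))"
    unfolding upper_density_def by (rule Limsup_mono)
  also have "\<dots> = ereal (real (card R) / real M)"
    by (rule lim_imp_Limsup[OF _ lim]) simp
  finally show ?thesis .
qed

text \<open>Expanding each factor as a geometric series would give the sum over all \<open>n\<close>
  composed of primes in \<open>S\<close>. Restricting to a finite \<open>F\<close> avoids infinite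
  sums. \<open>F\<close> varies in the induction, because splitting off the powers of
  \<open>p\<close> replaces it by the set of the \<open>p\<close>-free parts.\<close>

lemma sum_inverse_squares_le_euler_product:
  assumes "finite S" "\<And>p. p \<in> S \<Longrightarrow> prime p" "finite F"
    and "\<And>n. n \<in> F \<Longrightarrow> n > 0 \<and> prime_factors n \<subseteq> S"
  shows "(\<Sum>n\<in>F. 1 / (real n)\<^sup>2) \<le> (\<Prod>p\<in>S. 1 / (1 - 1 / (real p)\<^sup>2))"
  using assms
proof (induction S arbitrary: F rule: finite_induct)
  case empty
  have "n = 1" if "n \<in> F" for n
    using empty.prems(3)[OF that] by (auto simp: prime_factorization_empty_iff)
  then have "F \<subseteq> {1}" by auto
  then have "(\<Sum>n\<in>F. 1 / (real n)\<^sup>2) \<le> (\<Sum>n\<in>{1::nat}. 1 / (real n)\<^sup>2)"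
    by (intro sum_mono2) auto
  then show ?case by simp
next
  case (insert p S)
  have p: "prime p" using insert.prems by simp
  let ?q = "1 / (real p)\<^sup>2"
  have "real p > 1" using prime_gt_1_nat[OF p] by simp
  then have q: "0 < ?q" "?q < 1" by (simp_all add: power2_eq_square less_1_mult)
  \<comment> \<open>Coordinates of \<open>n\<close>: the exponent of \<open>p\<close> and the
    \<open>p\<close>-free part. In these, the summand becomes the product \<open>g\<close>.\<close>
  define d where "d = (\<lambda>n::nat. (multiplicity p n, n div p ^ multiplicity p n))"
  define g where "g = (\<lambda>(k, m). ?q ^ k * (1 / (real m)\<^sup>2))"
  have dec: "n = p ^ fst (d n) * snd (d n)" for n
    by (simp add: d_def multiplicity_dvd)
  have "inj_on d F"
    by (rule inj_onI) (metis dec)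
  have gd: "1 / (real n)\<^sup>2 = g (d n)" for n
  proof -
    have "real n = real p ^ fst (d n) * real (snd (d n))"
      using dec[of n] by (metis of_nat_mult of_nat_power)
    then show ?thesis
      by (simp add: g_def case_prod_beta power_divide power_mult_distrib flip: power_mult)
         (simp add: mult.commute)
  qed
  \<comment> \<open>Inserting 0 keeps \<open>Max\<close> meaningful when \<open>F\<close> is
    empty.\<close>
  define K where "K = Max (insert 0 (fst ` d ` F))"
  let ?G = "snd ` d ` F"
  have cover: "d ` F \<subseteq> {..K} \<times> ?G"
  proof
    fix z assume "z \<in> d ` F"
    then have "fst z \<le> K" "snd z \<in> ?G"
      using insert.prems(2) unfolding K_def by (auto intro!: Max_ge)
    then show "z \<in> {..K} \<times> ?G" by (cases z) auto
  qed
  have G: "m > 0 \<and> prime_factors m \<subseteq> S" if "m \<in> ?G" for m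
  proof -
    from that obtain n where n: "n \<in> F" "m = snd (d n)" by auto
    have n0: "n > 0" "prime_factors n \<subseteq> insert p S" using insert.prems(3)[OF n(1)] by auto
    have "m dvd n" using dec[of n] n by (metis dvd_triv_right)
    moreover have "\<not> p dvd m"
      using multiplicity_decompose[of n p] n0 n prime_gt_1_nat[OF p] by (simp add: d_def)
    ultimately have "prime_factors m \<subseteq> insert p S - {p}"
      using n0 dvd_prime_factors[of n m] by (auto simp: in_prime_factors_iff)
    then show ?thesis using \<open>m dvd n\<close> n0 by (auto intro: Nat.gr0I)
  qed
  have "(\<Sum>n\<in>F. 1 / (real n)\<^sup>2) = sum g (d ` F)"
    using \<open>inj_on d F\<close> by (simp add: sum.reindex gd)
  \<comment> \<open>Enlarging the image of \<open>d\<close> to a full rectangle adds only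
    nonnegative terms and makes the sum factor.\<close>
  also have "\<dots> \<le> sum g ({..K} \<times> ?G)"
    by (rule sum_mono2) (use cover insert.prems(2) in \<open>auto simp: g_def\<close>)
  also have "\<dots> = (\<Sum>k\<le>K. ?q ^ k) * (\<Sum>m\<in>?G. 1 / (real m)\<^sup>2)"
    by (simp add: g_def sum_product sum.cartesian_product)
  also have "\<dots> \<le> 1 / (1 - ?q) * (\<Prod>p\<in>S. 1 / (1 - 1 / (real p)\<^sup>2))"
  proof (rule mult_mono)
    have "(\<Sum>k\<le>K. ?q ^ k) = (1 - ?q ^ Suc K) / (1 - ?q)"
      using q by (simp only: sum_gp0) simp
    also have "\<dots> \<le> 1 / (1 - ?q)"
      using q by (intro divide_right_mono) auto
    finally show "(\<Sum>k\<le>K. ?q ^ k) \<le> 1 / (1 - ?q)" .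
    show "(\<Sum>m\<in>?G. 1 / (real m)\<^sup>2) \<le> (\<Prod>p\<in>S. 1 / (1 - 1 / (real p)\<^sup>2))"
      by (rule insert.IH) (use insert.prems G in auto)
  qed (use q in \<open>auto intro: sum_nonneg\<close>)
  finally show ?case using insert.hyps by simp
qed

text \<open>One \<open>r\<close> serves all \<open>a\<close> and \<open>p\<close> at once, because
  \<open>M\<close> is fixed beforehand. Divisibility by \<open>p\<^sup>2\<close> passes between
  \<open>a + r\<close> and \<open>a + n\<close> for every \<open>n\<close> in the class of
  \<open>r\<close> modulo \<open>M\<close>, and some witness \<open>n\<close> in that class exceeds
  the given \<open>a\<close>.\<close>

lemma property_Q_shift_not_dvd:
  assumes Q: "property_Q A" and M: "M > 0"
  obtains r where "\<And>a p. a \<in> A \<Longrightarrow> prime p \<Longrightarrow> p\<^sup>2 dvd M \<Longrightarrow> \<not> p\<^sup>2 dvd a + r"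
proof -
  let ?N = "{n. \<forall>a\<in>A. a < n \<longrightarrow> n + a \<in> SF}"
  have "finite ((\<lambda>n. n mod M) ` ?N)"
    by (rule finite_subset[of _ "{..<M}"]) (use M in auto)
  then obtain n0 where inf: "infinite {n \<in> ?N. n mod M = n0 mod M}"
    using pigeonhole_infinite[of ?N "\<lambda>n. n mod M"] Q by (auto simp: property_Q_def)
  have "\<not> p\<^sup>2 dvd a + n0" if a: "a \<in> A" and p: "prime p" "p\<^sup>2 dvd M" for a p
  proof
    assume dvd: "p\<^sup>2 dvd a + n0"
    obtain n where n: "n > a" "n \<in> ?N" "n mod M = n0 mod M"
      using inf unfolding infinite_nat_iff_unbounded by blast
    have "[n + a = n0 + a] (mod p\<^sup>2)"
      using n(3) p(2) by (metis cong_add_rcancel_nat cong_def cong_dvd_modulus_nat)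
    then have "p\<^sup>2 dvd n + a"
      using dvd by (simp add: cong_dvd_iff add.commute)
    moreover have "squarefree (n + a)"
      using n a by (auto simp: SF_def)
    ultimately have "p dvd 1"
      by (metis squarefreeD nat_dvd_1_iff_1)
    then show False using p(1) by simp
  qed
  then show thesis by (rule that)
qed

theorem theorem1p3:
  fixes A :: "nat set"
  assumes "property_Q A"
  shows "upper_density A \<le> ereal (6 / pi\<^sup>2)"
proof -
  define s :: "nat \<Rightarrow> real" where "s = (\<lambda>N. \<Sum>n<N. 1 / (real n + 1)\<^sup>2)"
  have bound: "upper_density A \<le> ereal (1 / s N)" if N: "N > 0" for N
  proof -
    define S where "S = {p. prime p \<and> p \<le> N}"
    have fin: "finite S" by (simp add: S_def)
    have pr: "prime p" if "p \<in> S" for p using that by (simp add: S_def)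
    define M where "M = (\<Prod>p\<in>S. p\<^sup>2)"
    have M: "M > 0" unfolding M_def by (rule prod_pos) (use pr prime_gt_0_nat in auto)
    obtain r where r: "\<And>a p. a \<in> A \<Longrightarrow> prime p \<Longrightarrow> p\<^sup>2 dvd M \<Longrightarrow> \<not> p\<^sup>2 dvd a + r"
      using property_Q_shift_not_dvd[OF assms M] by blast
    let ?R = "{x. x < M \<and> (\<forall>p\<in>S. \<not> p\<^sup>2 dvd x + r)}"
    have "a mod M \<in> ?R" if a: "a \<in> A" for a
    proof -
      have "\<not> p\<^sup>2 dvd a mod M + r" if p: "p \<in> S" for p
      proof -
        have dvd: "p\<^sup>2 dvd M" unfolding M_def using fin p by (rule dvd_prodI)
        then have "[a mod M + r = a + r] (mod p\<^sup>2)"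
          by (simp add: cong_def mod_mod_cancel flip: mod_add_left_eq[of "a mod M"] mod_add_left_eq[of a])
        then show ?thesis using r[OF a pr[OF p] dvd] by (simp add: cong_dvd_iff)
      qed
      then show ?thesis using M by simp
    qed
    then have "upper_density A \<le> ereal (real (card ?R) / real M)"
      by (intro upper_density_le_residues M) auto
    moreover have "real (card ?R) / real M \<le> 1 / s N"
    proof -
      have "card ?R \<le> (\<Prod>p\<in>S. p\<^sup>2 - 1)"
        unfolding M_def
        by (rule card_shift_not_dvd_le) (simp_all add: fin pr primes_coprime prime_gt_0_nat)
      then have "real (card ?R) \<le> real (\<Prod>p\<in>S. p\<^sup>2 - 1)"
        by (simp only: of_nat_le_iff)
      then have "real (card ?R) / real M \<le> real (\<Prod>p\<in>S. p\<^sup>2 - 1) / real M"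
        by (rule divide_right_mono) simp
      also have "\<dots> = (\<Prod>p\<in>S. 1 - 1 / (real p)\<^sup>2)"
        unfolding M_def of_nat_prod prod_dividef[symmetric]
      proof (rule prod.cong)
        fix p assume "p \<in> S"
        then have "p > 0" using pr prime_gt_0_nat by blast
        then show "real (p\<^sup>2 - 1) / real (p\<^sup>2) = 1 - 1 / (real p)\<^sup>2"
          by (simp add: of_nat_diff Suc_le_eq diff_divide_distrib)
      qed simp
      \<comment> \<open>Inverting the product gives it the form of the Euler product estimate, whose
        lower bound then becomes an upper bound.\<close>
      also have "\<dots> = 1 / (\<Prod>p\<in>S. 1 / (1 - 1 / (real p)\<^sup>2))"
        by (simp add: prod_dividef)
      also have "\<dots> \<le> 1 / s N"
      proof (rule divide_left_mono)
        have "s N = (\<Sum>n\<in>{1..N}. 1 / (real n)\<^sup>2)"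
          unfolding s_def by (rule sum.reindex_bij_witness[of _ "\<lambda>n. n - 1" Suc]) auto
        also have "\<dots> \<le> (\<Prod>p\<in>S. 1 / (1 - 1 / (real p)\<^sup>2))"
        proof (rule sum_inverse_squares_le_euler_product[OF fin pr])
          fix n assume "n \<in> {1..N}"
          then have n: "n > 0" "n \<le> N" by simp_all
          \<comment> \<open>All primes up to \<open>N\<close> are in \<open>S\<close>, so every
            \<open>n\<close> in \<open>{1..N}\<close> is covered.\<close>
          have "prime_factors n \<subseteq> S"
          proof
            fix p assume "p \<in> prime_factors n"
            then have "prime p" "p dvd n" by (simp_all add: in_prime_factors_iff)
            with n show "p \<in> S" unfolding S_def using dvd_imp_le[of p n] by simp
          qed
          with n show "n > 0 \<and> prime_factors n \<subseteq> S" by blast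
        qed simp_all
        finally show le: "s N \<le> (\<Prod>p\<in>S. 1 / (1 - 1 / (real p)\<^sup>2))" .
        have "s N > 0" unfolding s_def using N by (intro sum_pos) auto
        with le show "0 < (\<Prod>p\<in>S. 1 / (1 - 1 / (real p)\<^sup>2)) * s N" by simp
      qed simp
      finally show ?thesis .
    qed
    ultimately show ?thesis using order_trans by fastforce
  qed
  have "s \<longlonglongrightarrow> pi\<^sup>2 / 6"
    using inverse_squares_sums unfolding sums_def s_def by (simp add: add.commute)
  then have "(\<lambda>N. ereal (1 / s N)) \<longlonglongrightarrow> ereal (1 / (pi\<^sup>2 / 6))"
    by (intro tendsto_intros) auto
  then have "(\<lambda>N. ereal (1 / s N)) \<longlonglongrightarrow> ereal (6 / pi\<^sup>2)"
    by simp
  \<comment> \<open>The bound is used from \<open>N = 1\<close> on: \<open>s 0 = 0\<close>, so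
    \<open>1 / s 0\<close> takes the default value 0.\<close>
  then show ?thesis
    by (rule LIMSEQ_le_const) (rule exI[of _ 1], simp add: bound)
qed

end
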